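(* Suppose that $(X,d,m)$ is a metric measure space such that $X$ is indecomposable. Let $E\subset X$ be a closed $\mathring{BV}$-extension set. Then $E$ is indecomposable with respect to $E$.
   Context: A metric measure space $(X,d,m)$: $(X,d)$ is complete and separable and $m$ is a nonnegative Borel measure finite on bounded sets. $\mathrm{lip}\,u(x)=\limsup_{y\to x}|u(y)-u(x)|/d(x,y)$ if $x$ is an accumulation point, $0$ otherwise. For $u\in L^1_{loc}(X)$ and $A$ open, $|Du|(A):=\inf\{\liminf_n\int_A \mathrm{lip}\,u_n\,dm : u_n\in \mathrm{Lip}_{loc}(A),\ u_n\to u \text{ in } L^1_{loc}(m|_A)\}$ ($\mathrm{Lip}_{loc}$: locally Lipschitz); for $B$ Borel, $|Du|(B):=\inf\{|Du|(A): A\supset B \text{ open}\}$. For $B$ Borel and $u\in L^1_{loc}(m|_B)$, $|Du|_B$ is the total variation of $u$ computed in $(X,d,m|_B)$. For Borel sets $F\subset B$ and $G$, $P_B(F,G):=|D\chi_F|_B(B\cap G)$. Decomposability. Given Borel sets $E,B\subset X$, $E$ is decomposable with respect to $B$ if there is a partition of $E\cap B$ into Borel sets $F,G\subset E$ with $m(F),m(G)>0$ and $P_B(E,B)=P_B(F,B)+P_B(G,B)$; otherwise $E$ is indecomposable with respect to $B$. "(In)decomposable" without qualification means with respect to $X$. (For a closed set $E$ one has $P_E(E,E)=0$, so $E$ is decomposable with respect to $E$ iff it has a Borel partition $F,G$ with $m(F),m(G)>0$ and $P_E(F,E)=P_E(G,E)=0$.) $\mathring{BV}(B):=\{u\in L^1_{loc}(m|_B):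 |Du|_B(B)<\infty\}$ with seminorm $\|u\|_{\mathring{BV}(B)}=|Du|_B(B)$. A Borel set $E$ is a $\mathring{BV}$-extension set if there exist $C\ge1$ and a (not necessarily linear) map $T\colon\mathring{BV}(E)\to\mathring{BV}(X)$ with $Tu=u$ ($m$-a.e.) on $E$ and $\|Tu\|_{\mathring{BV}(X)}\le C\|u\|_{\mathring{BV}(E)}$ for every $u\in\mathring{BV}(E)$. *)

theory Defs
  imports "HOL-Analysis.Analysis"
begin

text \<open>
  The space \<open>(X, d)\<close> is a type of class \<^class>\<open>polish_space\<close>, i.e. a type with a complete metric
  and a second countable topology (for metric spaces the latter is separability). The whole
  space \<open>X\<close> is \<open>UNIV\<close>.
\<close>

definition metric_measure :: "'a::polish_space measure \<Rightarrow> bool" where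
  "metric_measure m \<longleftrightarrow>
     sets m = sets borel \<and> (\<forall>A\<in>sets borel. bounded A \<longrightarrow> emeasure m A < \<infinity>)"

text \<open>The measure \<open>m|\<^sub>B\<close> remains a measure on all of \<open>X\<close>; it maps \<open>A\<close> to \<open>m (A \<inter> B)\<close>.\<close>

definition restr :: "'a measure \<Rightarrow> 'a set \<Rightarrow> 'a measure" where
  "restr m B = density m (indicator B)"

definition lip :: "('a::metric_space \<Rightarrow> real) \<Rightarrow> 'a \<Rightarrow> ennreal" where
  "lip u x = (if x islimpt UNIV
     then Limsup (at x) (\<lambda>y. ennreal (\<bar>u y - u x\<bar> / dist y x)) else 0)"

text \<open>
  Functions on an open set \<open>A\<close> are represented by total functions whose values outside \<open>A\<close>
  are irrelevant; this affects neither \<open>lip u x\<close> for \<open>x \<in> A\<close> nor the notions below.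
\<close>

definition Lip_loc :: "'a::metric_space set \<Rightarrow> ('a \<Rightarrow> real) set" where
  "Lip_loc A = {u. \<forall>x\<in>A. \<exists>r>0. \<exists>L. L-lipschitz_on (ball x r \<inter> A) u}"

text \<open>``Locally'' means: on some neighbourhood of every point.\<close>

definition L1_loc :: "'a::metric_space measure \<Rightarrow> ('a \<Rightarrow> real) set" where
  "L1_loc M = {u. \<forall>x. \<exists>r>0. set_integrable M (ball x r) u}"

definition tendsto_L1_loc ::
    "'a::metric_space measure \<Rightarrow> 'a set \<Rightarrow> (nat \<Rightarrow> 'a \<Rightarrow> real) \<Rightarrow> ('a \<Rightarrow> real) \<Rightarrow> bool" where
  "tendsto_L1_loc M A w u \<longleftrightarrow>
     (\<forall>x\<in>A. \<exists>r>0. (\<lambda>n. \<integral>\<^sup>+y\<in>ball x r \<inter> A. ennreal \<bar>w n y - u y\<bar> \<partial>M) \<longlonglongrightarrow> 0)"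

definition total_variation_open ::
    "'a::metric_space measure \<Rightarrow> ('a \<Rightarrow> real) \<Rightarrow> 'a set \<Rightarrow> ennreal" where
  "total_variation_open M u A =
     Inf {liminf (\<lambda>n. \<integral>\<^sup>+x\<in>A. lip (w n) x \<partial>M) | w.
            (\<forall>n. w n \<in> Lip_loc A) \<and> tendsto_L1_loc M A w u}"

text \<open>
  For open \<open>B\<close> this agrees with \<open>total_variation_open\<close>, which is monotone in the open set.
\<close>

definition total_variation ::
    "'a::metric_space measure \<Rightarrow> ('a \<Rightarrow> real) \<Rightarrow> 'a set \<Rightarrow> ennreal" where
  "total_variation M u B = Inf {total_variation_open M u A | A. open A \<and> B \<subseteq> A}"

text \<open>\<open>perimeter m B F G\<close> is \<open>P\<^sub>B(F, G)\<close>.\<close>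

definition perimeter ::
    "'a::metric_space measure \<Rightarrow> 'a set \<Rightarrow> 'a set \<Rightarrow> 'a set \<Rightarrow> ennreal" where
  "perimeter m B F G = total_variation (restr m B) (indicator F) (B \<inter> G)"

text \<open>\<open>decomposable m E B\<close>: the set \<open>E\<close> is decomposable with respect to \<open>B\<close>.\<close>

definition decomposable :: "'a::metric_space measure \<Rightarrow> 'a set \<Rightarrow> 'a set \<Rightarrow> bool" where
  "decomposable m E B \<longleftrightarrow>
     (\<exists>F\<in>sets borel. \<exists>G\<in>sets borel.
        F \<subseteq> E \<and> G \<subseteq> E \<and> F \<union> G = E \<inter> B \<and> F \<inter> G = {} \<and>
        emeasure m F > 0 \<and> emeasure m G > 0 \<and>
        perimeter m B E B = perimeter m B F B + perimeter m B G B)"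

abbreviation indecomposable :: "'a::metric_space measure \<Rightarrow> 'a set \<Rightarrow> 'a set \<Rightarrow> bool" where
  "indecomposable m E B \<equiv> \<not> decomposable m E B"

definition hBV_norm :: "'a::metric_space measure \<Rightarrow> 'a set \<Rightarrow> ('a \<Rightarrow> real) \<Rightarrow> ennreal" where
  "hBV_norm m B u = total_variation (restr m B) u B"

definition hBV :: "'a::metric_space measure \<Rightarrow> 'a set \<Rightarrow> ('a \<Rightarrow> real) set" where
  "hBV m B = {u \<in> L1_loc (restr m B). hBV_norm m B u < \<infinity>}"

text \<open>
  Elements of \<open>hBV m B\<close> are representatives of classes of functions modulo equality
  \<open>m\<close>-almost everywhere on \<open>B\<close>. The second condition on \<open>T\<close> says that \<open>T\<close> is a map between
  such classes.
\<close>

definition hBV_extension_set :: "'a::metric_space measure \<Rightarrow> 'a set \<Rightarrow> bool" where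
  "hBV_extension_set m E \<longleftrightarrow> E \<in> sets borel \<and>
     (\<exists>C::real. C \<ge> 1 \<and> (\<exists>T :: ('a \<Rightarrow> real) \<Rightarrow> ('a \<Rightarrow> real).
        (\<forall>u\<in>hBV m E. T u \<in> hBV m UNIV) \<and>
        (\<forall>u\<in>hBV m E. \<forall>v\<in>hBV m E.
           (AE x in m. x \<in> E \<longrightarrow> u x = v x) \<longrightarrow> (AE x in m. T u x = T v x)) \<and>
        (\<forall>u\<in>hBV m E. AE x in m. x \<in> E \<longrightarrow> T u x = u x) \<and>
        (\<forall>u\<in>hBV m E. hBV_norm m UNIV (T u) \<le> ennreal C * hBV_norm m E u)))"

end

theory Submission imports Defs begin

text \<open>
  Suppose \<open>E = F \<union> G\<close> were a decomposition with respect to \<open>E\<close>. Constants have no variation, so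
  \<open>P\<^sub>E(E, E) = 0\<close> and therefore \<open>P\<^sub>E(F, E) = 0\<close>: the indicator of \<open>F\<close> has seminorm zero on \<open>E\<close>.
  The norm bound forces its extension \<open>v\<close> to have total variation zero on the whole space, while
  \<open>v = 1\<close> a.e. on \<open>F\<close> and \<open>v = 0\<close> a.e. on \<open>G\<close>. Hence the superlevel set \<open>{v > 0}\<close> and its
  complement both have positive measure, and it remains to see that they have perimeter zero: then
  they decompose \<open>X\<close>.

  The usual tool for the last step is the coarea formula, which controls almost every superlevel
  set. As \<open>v\<close> has variation exactly zero, a cheaper argument handles every level \<open>t\<close>. The ramps
  \<open>s \<mapsto> min 1 (max 0 (c (s - t)))\<close> are \<open>c\<close>-Lipschitz, so composing with one multiplies the
  variation by at most \<open>c\<close> and leaves it zero; and as \<open>c \<rightarrow> \<infinity>\<close> the ramps of \<open>v\<close> converge to the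
  indicator of \<open>{v > t}\<close>. To conclude one has to choose a diagonal sequence among the locally
  Lipschitz approximations of the different ramps of \<open>v\<close>. Local \<open>L\<^sup>1\<close> convergence is an obstacle
  here, because the neighbourhoods on which it takes place depend on the sequence, and the space
  need not be locally compact. For uniformly bounded functions the obstacle vanishes: a countable
  subcover shows that they converge in \<open>L\<^sup>1\<close> on every set of finite measure
  (\<open>tendsto_L1_loc_bounded\<close>), in particular on the balls around one fixed centre. The diagonal
  choice is made in \<open>exists_ramp_approximation\<close> and \<open>superlevel_total_variation_zero\<close>.
\<close>

section \<open>Lipschitz post-composition\<close>

text \<open>
  This serves for integrands like \<open>lip u\<close>, whose measurability is not established. The
  integral is a supremum over simple functions, and dividing by \<open>c\<close> turns a simple function below
  \<open>f\<close> into one below \<open>g\<close>.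
\<close>

lemma nn_integral_cmult_le:
  fixes f g :: "'a \<Rightarrow> ennreal"
  assumes le: "\<And>x. f x \<le> ennreal c * g x" and c: "0 \<le> c"
  shows "(\<integral>\<^sup>+x. f x \<partial>M) \<le> ennreal c * (\<integral>\<^sup>+x. g x \<partial>M)"
proof (cases "c = 0")
  case True
  then have "f = (\<lambda>x. 0)" using le by (auto simp: fun_eq_iff)
  then show ?thesis by simp
next
  case False
  with c have c0: "c > 0" by simp
  have "(\<integral>\<^sup>+x. f x \<partial>M) = (SUP s \<in> {s. simple_function M s \<and> s \<le> f}. integral\<^sup>S M s)"
    by (simp add: nn_integral_def)
  also have "\<dots> \<le> ennreal c * (\<integral>\<^sup>+x. g x \<partial>M)"
  proof (rule SUP_least)
    fix s assume "s \<in> {s. simple_function M s \<and> s \<le> f}"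
    then have s: "simple_function M s" "\<And>x. s x \<le> f x" by (auto simp: le_fun_def)
    have inv: "ennreal c * (ennreal (1 / c) * a) = a" for a
    proof -
      have "ennreal c * ennreal (1 / c) = 1"
        using c0 by (simp flip: ennreal_mult)
      then show ?thesis by (simp flip: mult.assoc)
    qed
    have le': "ennreal (1/c) * s x \<le> g x" for x
    proof -
      have "ennreal (1/c) * s x \<le> ennreal (1/c) * (ennreal c * g x)"
        using s(2)[of x] le[of x] by (intro mult_left_mono) auto
      also have "\<dots> = g x" using inv[of "g x"] by (simp add: mult.left_commute)
      finally show ?thesis .
    qed
    have "integral\<^sup>S M s = (\<integral>\<^sup>+x. s x \<partial>M)"
      using s(1) by (simp add: nn_integral_eq_simple_integral)
    also have "\<dots> = ennreal c * (ennreal (1/c) * (\<integral>\<^sup>+x. s x \<partial>M))"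
      using inv by simp
    also have "\<dots> = ennreal c * (\<integral>\<^sup>+x. ennreal (1/c) * s x \<partial>M)"
      using s(1) by (simp add: nn_integral_cmult borel_measurable_simple_function)
    also have "\<dots> \<le> ennreal c * (\<integral>\<^sup>+x. g x \<partial>M)"
      by (intro mult_left_mono nn_integral_mono le') auto
    finally show "integral\<^sup>S M s \<le> ennreal c * (\<integral>\<^sup>+x. g x \<partial>M)" .
  qed
  finally show ?thesis .
qed

lemma tendsto_ennreal_zero_le:
  fixes f g :: "nat \<Rightarrow> ennreal"
  assumes "g \<longlonglongrightarrow> 0" "\<And>n. n \<ge> N \<Longrightarrow> f n \<le> g n"
  shows "f \<longlonglongrightarrow> 0"
proof (rule tendsto_sandwich[OF _ _ tendsto_const assms(1)])
  show "\<forall>\<^sub>F n in sequentially. f n \<le> g n"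
    using assms(2) unfolding eventually_sequentially by blast
qed simp

lemma lip_const [simp]: "lip (\<lambda>_. c) x = 0"
proof (cases "x islimpt UNIV")
  case True
  then have "at x \<noteq> bot" by (simp add: trivial_limit_within)
  then show ?thesis by (simp add: lip_def Limsup_const)
qed (simp add: lip_def)

lemma lip_compose_le:
  assumes "L-lipschitz_on UNIV \<phi>"
  shows "lip (\<lambda>x. \<phi> (w x)) x \<le> ennreal L * lip w x"
proof (cases "x islimpt UNIV")
  case True
  then have nb: "at x \<noteq> bot" by (simp add: trivial_limit_within)
  have L: "0 \<le> L" by (rule lipschitz_on_nonneg[OF assms])
  have le: "ennreal (\<bar>\<phi> (w y) - \<phi> (w x)\<bar> / dist y x)
      \<le> ennreal L * ennreal (\<bar>w y - w x\<bar> / dist y x)" for y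
  proof -
    have "\<bar>\<phi> (w y) - \<phi> (w x)\<bar> \<le> L * \<bar>w y - w x\<bar>"
      using lipschitz_onD[OF assms, of "w y" "w x"] by (simp add: dist_real_def)
    then have "\<bar>\<phi> (w y) - \<phi> (w x)\<bar> / dist y x \<le> L * (\<bar>w y - w x\<bar> / dist y x)"
      by (simp add: divide_right_mono)
    then show ?thesis using L by (simp flip: ennreal_mult add: ennreal_leI)
  qed
  have "Limsup (at x) (\<lambda>y. ennreal (\<bar>\<phi> (w y) - \<phi> (w x)\<bar> / dist y x))
      \<le> Limsup (at x) (\<lambda>y. ennreal L * ennreal (\<bar>w y - w x\<bar> / dist y x))"
    using le by (intro Limsup_mono always_eventually allI) 
  also have "\<dots> = ennreal L * Limsup (at x) (\<lambda>y. ennreal (\<bar>w y - w x\<bar> / dist y x))"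
  proof (rule Limsup_compose_continuous_mono[OF _ _ nb])
    show "continuous_on UNIV (\<lambda>a. ennreal L * a)"
      unfolding continuous_on_def by (auto intro: ennreal_tendsto_cmult)
    show "mono (\<lambda>a. ennreal L * a)" by (intro monoI mult_left_mono) auto
  qed
  finally show ?thesis using True by (simp add: lip_def)
qed (simp add: lip_def)

lemma Lip_loc_compose:
  assumes "L-lipschitz_on UNIV \<phi>" "w \<in> Lip_loc A"
  shows "(\<lambda>x. \<phi> (w x)) \<in> Lip_loc A"
  unfolding Lip_loc_def
proof (clarify)
  fix x assume "x \<in> A"
  then obtain r K where r: "r > 0" "K-lipschitz_on (ball x r \<inter> A) w"
    using assms(2) by (auto simp: Lip_loc_def)
  have "(L * K)-lipschitz_on (ball x r \<inter> A) (\<lambda>y. \<phi> (w y))"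
    using lipschitz_on_compose2[OF r(2) lipschitz_on_subset[OF assms(1)]] by simp
  then show "\<exists>r>0. \<exists>L. L-lipschitz_on (ball x r \<inter> A) (\<lambda>y. \<phi> (w y))"
    using r(1) by blast
qed

lemma Lip_loc_borel_measurable:
  assumes "w \<in> Lip_loc UNIV"
  shows "w \<in> borel_measurable borel"
proof (rule borel_measurable_continuous_onI, unfold continuous_on_eq_continuous_at[OF open_UNIV], clarify)
  fix x
  have "\<exists>r>0. \<exists>K. K-lipschitz_on (ball x r) w"
    using assms by (simp add: Lip_loc_def)
  then obtain r K where r: "r > 0" "K-lipschitz_on (ball x r) w" by blast
  show "isCont w x"
    using lipschitz_on_continuous_on[OF r(2)] r(1)
    by (simp add: continuous_on_eq_continuous_at)
qed

lemma tendsto_L1_loc_compose: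
  assumes L: "L-lipschitz_on UNIV \<phi>" and w: "tendsto_L1_loc M A w u"
  shows "tendsto_L1_loc M A (\<lambda>n x. \<phi> (w n x)) (\<lambda>x. \<phi> (u x))"
  unfolding tendsto_L1_loc_def
proof (clarify)
  fix x assume "x \<in> A"
  then obtain r where r: "r > 0"
    and lim: "(\<lambda>n. \<integral>\<^sup>+y\<in>ball x r \<inter> A. ennreal \<bar>w n y - u y\<bar> \<partial>M) \<longlonglongrightarrow> 0"
    using w by (auto simp: tendsto_L1_loc_def)
  have L0: "0 \<le> L" by (rule lipschitz_on_nonneg[OF L])
  have le: "(\<integral>\<^sup>+y\<in>ball x r \<inter> A. ennreal \<bar>\<phi> (w n y) - \<phi> (u y)\<bar> \<partial>M)
      \<le> ennreal L * (\<integral>\<^sup>+y\<in>ball x r \<inter> A. ennreal \<bar>w n y - u y\<bar> \<partial>M)" for n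
  proof (rule nn_integral_cmult_le[OF _ L0])
    fix y
    have "\<bar>\<phi> (w n y) - \<phi> (u y)\<bar> \<le> L * \<bar>w n y - u y\<bar>"
      using lipschitz_onD[OF L, of "w n y" "u y"] by (simp add: dist_real_def)
    then show "ennreal \<bar>\<phi> (w n y) - \<phi> (u y)\<bar> * indicator (ball x r \<inter> A) y
      \<le> ennreal L * (ennreal \<bar>w n y - u y\<bar> * indicator (ball x r \<inter> A) y)"
      using L0 by (simp flip: ennreal_mult add: ennreal_leI indicator_def)
  qed
  have "(\<lambda>n. ennreal L * (\<integral>\<^sup>+y\<in>ball x r \<inter> A. ennreal \<bar>w n y - u y\<bar> \<partial>M)) \<longlonglongrightarrow> ennreal L * 0"
    by (intro ennreal_tendsto_cmult lim) simp
  then have "(\<lambda>n. ennreal L * (\<integral>\<^sup>+y\<in>ball x r \<inter> A. ennreal \<bar>w n y - u y\<bar> \<partial>M)) \<longlonglongrightarrow> 0"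
    by simp
  then have "(\<lambda>n. \<integral>\<^sup>+y\<in>ball x r \<inter> A. ennreal \<bar>\<phi> (w n y) - \<phi> (u y)\<bar> \<partial>M) \<longlonglongrightarrow> 0"
    by (rule tendsto_ennreal_zero_le) (rule le)
  then show "\<exists>r>0. (\<lambda>n. \<integral>\<^sup>+y\<in>ball x r \<inter> A. ennreal \<bar>\<phi> (w n y) - \<phi> (u y)\<bar> \<partial>M) \<longlonglongrightarrow> 0"
    using r by blast
qed

lemma total_variation_open_le:
  assumes "\<And>n. w n \<in> Lip_loc A" "tendsto_L1_loc M A w u"
  shows "total_variation_open M u A \<le> liminf (\<lambda>n. \<integral>\<^sup>+x\<in>A. lip (w n) x \<partial>M)"
  unfolding total_variation_open_def using assms by (intro Inf_lower) blast

text \<open>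
  With \<open>\<phi> s = 1 - s\<close> this transfers perimeter zero from a set to its complement.
\<close>

lemma total_variation_open_compose_contraction:
  assumes "1-lipschitz_on UNIV \<phi>"
  shows "total_variation_open M (\<lambda>x. \<phi> (u x)) A \<le> total_variation_open M u A"
  unfolding total_variation_open_def[of M u A]
proof (rule Inf_greatest, clarify)
  fix w assume w: "\<forall>n. w n \<in> Lip_loc A" "tendsto_L1_loc M A w u"
  have "total_variation_open M (\<lambda>x. \<phi> (u x)) A
      \<le> liminf (\<lambda>n. \<integral>\<^sup>+x\<in>A. lip (\<lambda>x. \<phi> (w n x)) x \<partial>M)"
    using w by (intro total_variation_open_le Lip_loc_compose[OF assms] tendsto_L1_loc_compose[OF assms]) auto
  also have "\<dots> \<le> liminf (\<lambda>n. \<integral>\<^sup>+x\<in>A. lip (w n) x \<partial>M)"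
    using lip_compose_le[OF assms]
    by (intro Liminf_mono always_eventually allI nn_integral_mono mult_right_mono) auto
  finally show "total_variation_open M (\<lambda>x. \<phi> (u x)) A
      \<le> liminf (\<lambda>n. \<integral>\<^sup>+x\<in>A. lip (w n) x \<partial>M)" .
qed

lemma total_variation_UNIV: "total_variation M u UNIV = total_variation_open M u UNIV"
proof -
  have "{total_variation_open M u A | A. open A \<and> UNIV \<subseteq> A} = {total_variation_open M u UNIV}"
    by (auto simp: top.extremum_unique)
  then show ?thesis by (simp add: total_variation_def)
qed

section \<open>From local to global information in a separable space\<close>

lemma countable_subcover_balls:
  fixes r :: "'a::{metric_space, second_countable_topology} \<Rightarrow> real"
  assumes "\<And>x. r x > 0"
  obtains c :: "nat \<Rightarrow> 'a" where "(\<Union>j. ball (c j) (r (c j))) = UNIV"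
proof -
  obtain F' where F': "F' \<subseteq> (\<lambda>x. ball x (r x)) ` UNIV" "countable F'" "\<Union>F' = \<Union>((\<lambda>x. ball x (r x)) ` UNIV)"
    using Lindelof[of "(\<lambda>x. ball x (r x)) ` UNIV"] by auto
  then obtain C where C: "countable C" "F' = (\<lambda>x. ball x (r x)) ` C"
    using countable_subset_image[of F' "\<lambda>x. ball x (r x)" UNIV] by auto
  have all: "\<Union>((\<lambda>x. ball x (r x)) ` C) = UNIV"
    using F'(3) C(2) assms by (metis UNIV_eq_I UNIV_I UN_I centre_in_ball)
  then have "C \<noteq> {}" by auto
  then have C_eq: "range (from_nat_into C) = C" using C(1) by (simp add: range_from_nat_into)
  have "(\<Union>j. ball (from_nat_into C j) (r (from_nat_into C j)))
      = \<Union>((\<lambda>x. ball x (r x)) ` range (from_nat_into C))" by (simp add: image_image)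
  also have "\<dots> = UNIV" unfolding C_eq by (rule all)
  finally have "(\<Union>j. ball (from_nat_into C j) (r (from_nat_into C j))) = UNIV" .
  then show ?thesis by (rule that)
qed

lemma L1_loc_borel_measurable:
  fixes u :: "'a::polish_space \<Rightarrow> real"
  assumes u: "u \<in> L1_loc M" and M: "sets M = sets borel"
  shows "u \<in> borel_measurable borel"
proof -
  have "\<forall>x. \<exists>r>0. set_integrable M (ball x r) u" using u by (simp add: L1_loc_def)
  then obtain r where r: "\<And>x. r x > 0" "\<And>x. set_integrable M (ball x (r x)) u" by metis
  obtain c where c: "(\<Union>j::nat. ball (c j) (r (c j))) = UNIV"
    by (rule countable_subcover_balls[OF r(1)])
  show ?thesis
  proof (rule measurable_piecewise_restrict[of "range (\<lambda>j. ball (c j) (r (c j)))"])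
    fix S assume "S \<in> range (\<lambda>j. ball (c j) (r (c j)))"
    then obtain j where S: "S = ball (c j) (r (c j))" by auto
    show "S \<inter> space borel \<in> sets borel" by (simp add: S)
    have "(\<lambda>x. indicator S x *\<^sub>R u x) \<in> borel_measurable M"
      using r(2)[of "c j"] unfolding S set_integrable_def by (rule borel_measurable_integrable)
    then show "u \<in> borel_measurable (restrict_space borel S)"
      by (simp add: S borel_measurable_restrict_space_iff measurable_cong_sets[OF M refl])
  qed (use c in auto)
qed

text \<open>
  Countably many of the balls on which \<open>w\<close> converges cover the space. Finitely many of them cover
  \<open>B\<close> up to a set of small measure, and on that remainder the integrand is at most \<open>1\<close>.
\<close>

lemma tendsto_L1_loc_bounded:
  fixes M :: "'a::polish_space measure"
  assumes M: "sets M = sets borel"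
    and w: "\<And>n. w n \<in> borel_measurable borel" and u: "u \<in> borel_measurable borel"
    and le1: "\<And>n x. \<bar>w n x - u x\<bar> \<le> 1"
    and lim: "tendsto_L1_loc M UNIV w u"
    and B: "B \<in> sets borel" "emeasure M B < \<infinity>"
  shows "(\<lambda>n. \<integral>\<^sup>+y\<in>B. ennreal \<bar>w n y - u y\<bar> \<partial>M) \<longlonglongrightarrow> 0"
proof -
  have [measurable]: "w n \<in> borel_measurable M" "u \<in> borel_measurable M" for n
    using w u by (simp_all add: measurable_cong_sets[OF M refl])
  have [measurable_cong]: "sets M = sets borel" by (rule M)
  note [measurable] = B(1)
  define f where "f n y = ennreal \<bar>w n y - u y\<bar>" for n y
  have [measurable]: "f n \<in> borel_measurable M" for n unfolding f_def by measurable
  have "\<forall>x. \<exists>r>0. (\<lambda>n. \<integral>\<^sup>+y\<in>ball x r. f n y \<partial>M) \<longlonglongrightarrow> 0"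
    using lim by (simp add: tendsto_L1_loc_def f_def)
  from choice[OF this]
  obtain r where r: "\<And>x. r x > 0" "\<And>x. (\<lambda>n. \<integral>\<^sup>+y\<in>ball x (r x). f n y \<partial>M) \<longlonglongrightarrow> 0"
    by blast
  obtain c where c: "(\<Union>j::nat. ball (c j) (r (c j))) = UNIV"
    by (rule countable_subcover_balls[OF r(1)])
  define D where "D j = ball (c j) (r (c j))" for j
  have [measurable]: "D j \<in> sets borel" for j by (simp add: D_def)
  define R where "R J = B - (\<Union>j<J. D j)" for J
  have [measurable]: "R J \<in> sets borel" for J unfolding R_def by measurable
  have "(\<lambda>J. emeasure M (R J)) \<longlonglongrightarrow> emeasure M (\<Inter>J. R J)"
  proof (rule Lim_emeasure_decseq)
    show "range R \<subseteq> sets M" by auto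
    show "decseq R"
    proof (rule decseq_SucI)
      show "R (Suc J) \<subseteq> R J" for J by (auto simp: R_def less_Suc_eq)
    qed
    show "emeasure M (R J) \<noteq> \<infinity>" for J
    proof -
      have "emeasure M (R J) \<le> emeasure M B" by (rule emeasure_mono) (auto simp: R_def)
      then show ?thesis using B(2) by auto
    qed
  qed
  moreover have "(\<Inter>J. R J) = {}" using c unfolding R_def D_def by blast
  ultimately have R0: "(\<lambda>J. emeasure M (R J)) \<longlonglongrightarrow> 0" by simp
  have bound: "(\<integral>\<^sup>+y\<in>B. f n y \<partial>M) \<le> emeasure M (R J) + (\<Sum>j<J. \<integral>\<^sup>+y\<in>D j. f n y \<partial>M)" for n J
  proof -
    have "(\<integral>\<^sup>+y\<in>B. f n y \<partial>M) \<le> (\<integral>\<^sup>+y. indicator (R J) y + (\<Sum>j<J. f n y * indicator (D j) y) \<partial>M)"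
    proof (rule nn_integral_mono)
      fix y
      consider "y \<notin> B" | "y \<in> R J" | j where "j < J" "y \<in> D j" unfolding R_def by blast
      then show "f n y * indicator B y \<le> indicator (R J) y + (\<Sum>j<J. f n y * indicator (D j) y)"
      proof cases
        case 2
        have "f n y * indicator B y \<le> 1"
          using le1[of n y] by (auto simp: f_def indicator_def)
        also have "1 \<le> indicator (R J) y + (\<Sum>j<J. f n y * indicator (D j) y)"
          using 2 by simp
        finally show ?thesis .
      next
        case 3
        have "f n y * indicator B y \<le> f n y * indicator (D j) y"
          using 3 by (auto simp: indicator_def)
        also have "\<dots> \<le> (\<Sum>j<J. f n y * indicator (D j) y)"
          using 3 by (intro member_le_sum) auto
        also have "\<dots> \<le> indicator (R J) y + (\<Sum>j<J. f n y * indicator (D j) y)" by simp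
        finally show ?thesis .
      qed simp
    qed
    also have "\<dots> = emeasure M (R J) + (\<Sum>j<J. \<integral>\<^sup>+y\<in>D j. f n y \<partial>M)"
    proof -
      have "(\<integral>\<^sup>+y. indicator (R J) y + (\<Sum>j<J. f n y * indicator (D j) y) \<partial>M)
          = (\<integral>\<^sup>+y. indicator (R J) y \<partial>M) + (\<integral>\<^sup>+y. (\<Sum>j<J. f n y * indicator (D j) y) \<partial>M)"
        by (rule nn_integral_add) measurable
      also have "(\<integral>\<^sup>+y. (\<Sum>j<J. f n y * indicator (D j) y) \<partial>M) = (\<Sum>j<J. \<integral>\<^sup>+y\<in>D j. f n y \<partial>M)"
        by (rule nn_integral_sum) measurable
      finally show ?thesis by (simp add: M)
    qed
    finally show ?thesis .
  qed
  have "(\<lambda>n. \<integral>\<^sup>+y\<in>B. f n y \<partial>M) \<longlonglongrightarrow> 0"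
  proof (rule order_tendstoI)
    fix e :: ennreal assume e: "0 < e"
    have "\<forall>\<^sub>F J in sequentially. emeasure M (R J) < e" by (rule order_tendstoD(2)[OF R0 e])
    then obtain J where J: "emeasure M (R J) < e" by (auto simp: eventually_sequentially)
    have "(\<lambda>n. emeasure M (R J) + (\<Sum>j<J. \<integral>\<^sup>+y\<in>D j. f n y \<partial>M)) \<longlonglongrightarrow> emeasure M (R J) + (\<Sum>j<J. 0)"
      unfolding D_def by (intro tendsto_add tendsto_sum tendsto_const r(2))
    then have "\<forall>\<^sub>F n in sequentially. emeasure M (R J) + (\<Sum>j<J. \<integral>\<^sup>+y\<in>D j. f n y \<partial>M) < e"
      by (rule order_tendstoD(2)) (simp add: J)
    then show "\<forall>\<^sub>F n in sequentially. (\<integral>\<^sup>+y\<in>B. f n y \<partial>M) < e"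
      by eventually_elim (rule le_less_trans[OF bound])
  qed simp
  then show ?thesis by (simp add: f_def)
qed

section \<open>Superlevel sets of functions of total variation zero\<close>

definition ramp :: "real \<Rightarrow> real \<Rightarrow> real \<Rightarrow> real" where
  "ramp c t s = min 1 (max 0 (c * (s - t)))"

lemma ramp_lipschitz:
  assumes "0 \<le> c"
  shows "c-lipschitz_on UNIV (ramp c t)"
proof (rule lipschitz_onI[OF _ assms])
  fix a b
  have "\<bar>ramp c t a - ramp c t b\<bar> \<le> \<bar>c * (a - t) - c * (b - t)\<bar>"
    by (auto simp: ramp_def)
  also have "\<dots> = c * \<bar>a - b\<bar>" 
    using assms by (simp add: abs_mult flip: right_diff_distrib)
  finally show "dist (ramp c t a) (ramp c t b) \<le> c * dist a b" by (simp add: dist_real_def)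
qed

lemma ramp_bounds: "0 \<le> ramp c t s" "ramp c t s \<le> 1"
  by (auto simp: ramp_def)

lemma ramp_measurable [measurable]: "ramp c t \<in> borel_measurable borel"
  unfolding ramp_def[abs_def] by measurable

lemma ramp_tendsto_indicator:
  "(\<lambda>k. ramp (real (Suc k)) t (v x)) \<longlonglongrightarrow> indicator {x. t < v x} x"
proof (cases "t < v x")
  case True
  obtain K where K: "1 / (v x - t) \<le> real K" using real_arch_simple by blast
  have "ramp (real (Suc k)) t (v x) = 1" if "k \<ge> K" for k
  proof -
    have "1 / (v x - t) \<le> real (Suc k)" using K that by simp
    then have "1 \<le> real (Suc k) * (v x - t)" using True by (simp add: divide_le_eq del: of_nat_Suc)
    then show ?thesis by (simp add: ramp_def)
  qed
  then have "(\<lambda>k. ramp (real (Suc k)) t (v x)) \<longlonglongrightarrow> 1"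
    by (intro tendsto_eventually) (auto simp: eventually_sequentially simp del: of_nat_Suc)
  then show ?thesis using True by simp
next
  case False
  then have "real (Suc k) * (v x - t) \<le> 0" for k by (simp add: mult_le_0_iff)
  then have "ramp (real (Suc k)) t (v x) = 0" for k unfolding ramp_def by (metis max_absorb1 min_absorb2 zero_le_one)
  then show ?thesis using False by (simp del: of_nat_Suc)
qed

text \<open>
  The ramp multiplies the energy of an approximation \<open>w\<close> of \<open>v\<close> by at most \<open>c\<close>, and since \<open>v\<close>
  has variation zero that energy can be made smaller than \<open>e / c\<close>. The values of the ramps lie in
  \<open>[0, 1]\<close>, hence the closeness holds on a bounded set that is prescribed in advance.
\<close>

lemma exists_ramp_approximation:
  fixes m :: "'a::polish_space measure"
  assumes m: "metric_measure m"
    and v: "v \<in> borel_measurable borel"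
    and tv: "total_variation_open m v UNIV = 0"
    and B: "B \<in> sets borel" "bounded B"
    and c: "c > 0" and e: "e > 0"
  obtains g where "g \<in> Lip_loc UNIV" "(\<integral>\<^sup>+x. lip g x \<partial>m) \<le> ennreal e"
    "(\<integral>\<^sup>+y\<in>B. ennreal \<bar>g y - ramp c t (v y)\<bar> \<partial>m) \<le> ennreal e"
proof -
  have M: "sets m = sets borel" and finB: "emeasure m B < \<infinity>"
    using m B by (auto simp: metric_measure_def)
  have L: "c-lipschitz_on UNIV (ramp c t)" using c by (intro ramp_lipschitz) simp
  have "total_variation_open m v UNIV < ennreal (e / c)" using tv c e by simp
  then obtain w where w: "\<And>n. w n \<in> Lip_loc UNIV" "tendsto_L1_loc m UNIV w v"
    and lw: "liminf (\<lambda>n. \<integral>\<^sup>+x. lip (w n) x \<partial>m) < ennreal (e / c)"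
    unfolding total_variation_open_def Inf_less_iff by auto
  define g where "g n x = ramp c t (w n x)" for n x
  have g: "g n \<in> Lip_loc UNIV" for n unfolding g_def by (rule Lip_loc_compose[OF L w(1)])
  have gv: "tendsto_L1_loc m UNIV g (\<lambda>x. ramp c t (v x))"
    unfolding g_def by (rule tendsto_L1_loc_compose[OF L w(2)])
  have "(\<lambda>n. \<integral>\<^sup>+y\<in>B. ennreal \<bar>g n y - ramp c t (v y)\<bar> \<partial>m) \<longlonglongrightarrow> 0"
  proof (rule tendsto_L1_loc_bounded[OF M Lip_loc_borel_measurable[OF g] _ _ gv B(1) finB])
    show "(\<lambda>x. ramp c t (v x)) \<in> borel_measurable borel" using v by measurable
    show "\<bar>g n x - ramp c t (v x)\<bar> \<le> 1" for n x
      using ramp_bounds[of c t "w n x"] ramp_bounds[of c t "v x"] by (simp add: g_def)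
  qed
  then have ev: "\<forall>\<^sub>F n in sequentially. (\<integral>\<^sup>+y\<in>B. ennreal \<bar>g n y - ramp c t (v y)\<bar> \<partial>m) < ennreal e"
    by (rule order_tendstoD(2)) (use e in simp)
  \<comment> \<open>The lower limit only makes the energy small infinitely often, but the closeness on \<open>B\<close> holds
    eventually, so some index has both.\<close>
  have "\<exists>\<^sub>F n in sequentially. (\<integral>\<^sup>+x. lip (w n) x \<partial>m) < ennreal (e / c)"
  proof (rule ccontr)
    assume "\<not> ?thesis"
    then have "\<forall>\<^sub>F n in sequentially. ennreal (e / c) \<le> (\<integral>\<^sup>+x. lip (w n) x \<partial>m)"
      by (simp add: not_frequently not_less)
    then have "ennreal (e / c) \<le> liminf (\<lambda>n. \<integral>\<^sup>+x. lip (w n) x \<partial>m)" by (rule Liminf_bounded)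
    then show False using lw by simp
  qed
  from frequently_eventually_conj[OF this ev]
  obtain n where n: "(\<integral>\<^sup>+x. lip (w n) x \<partial>m) < ennreal (e / c)"
    "(\<integral>\<^sup>+y\<in>B. ennreal \<bar>g n y - ramp c t (v y)\<bar> \<partial>m) < ennreal e"
    by (auto dest: frequently_ex)
  have "(\<integral>\<^sup>+x. lip (g n) x \<partial>m) \<le> ennreal c * (\<integral>\<^sup>+x. lip (w n) x \<partial>m)"
    unfolding g_def using lip_compose_le[OF L] c by (intro nn_integral_cmult_le) auto
  also have "\<dots> \<le> ennreal c * ennreal (e / c)" using n(1) by (intro mult_left_mono) auto
  also have "\<dots> = ennreal e" using c e by (simp flip: ennreal_mult)
  finally have "(\<integral>\<^sup>+x. lip (g n) x \<partial>m) \<le> ennreal e" .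
  then show ?thesis
    using n(2) g[of n] by (intro that[of "g n"]) (auto simp: less_imp_le)
qed

text \<open>
  For the \<open>k\<close>-th member of the diagonal sequence the slope of the ramp, the radius of the ball and
  the inverse of the tolerance are all \<open>k + 1\<close>. Every ball of radius \<open>1\<close> is eventually contained in
  these balls, and on it the ramps of \<open>v\<close> converge to the indicator by dominated convergence.
\<close>

lemma superlevel_total_variation_zero:
  fixes m :: "'a::polish_space measure"
  assumes m: "metric_measure m"
    and v: "v \<in> borel_measurable borel"
    and tv: "total_variation_open m v UNIV = 0"
  shows "total_variation_open m (indicator {x. t < v x}) UNIV = 0"
proof -
  have M [measurable_cong]: "sets m = sets borel" using m by (simp add: metric_measure_def)
  note [measurable] = v
  \<comment> \<open>any point will do as the centre of the exhausting balls\<close>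
  define x0 :: 'a where "x0 = undefined"
  let ?c = "\<lambda>k. real (Suc k)"
  let ?\<chi> = "indicator {x. t < v x} :: 'a \<Rightarrow> real"
  have "\<exists>g. g \<in> Lip_loc UNIV \<and> (\<integral>\<^sup>+x. lip g x \<partial>m) \<le> ennreal (1 / ?c k) \<and>
      (\<integral>\<^sup>+y\<in>ball x0 (?c k). ennreal \<bar>g y - ramp (?c k) t (v y)\<bar> \<partial>m) \<le> ennreal (1 / ?c k)" for k
    by (rule exists_ramp_approximation[OF m v tv, of "ball x0 (?c k)" "?c k" "1 / ?c k" t])
      (simp_all, blast)
  then have "\<forall>k. \<exists>g. g \<in> Lip_loc UNIV \<and> (\<integral>\<^sup>+x. lip g x \<partial>m) \<le> ennreal (1 / ?c k) \<and>
      (\<integral>\<^sup>+y\<in>ball x0 (?c k). ennreal \<bar>g y - ramp (?c k) t (v y)\<bar> \<partial>m) \<le> ennreal (1 / ?c k)"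
    by (rule allI)
  from choice[OF this] obtain g where g: "\<And>k. g k \<in> Lip_loc UNIV"
    and gl: "\<And>k. (\<integral>\<^sup>+x. lip (g k) x \<partial>m) \<le> ennreal (1 / ?c k)"
    and gr: "\<And>k. (\<integral>\<^sup>+y\<in>ball x0 (?c k). ennreal \<bar>g k y - ramp (?c k) t (v y)\<bar> \<partial>m) \<le> ennreal (1 / ?c k)"
    by blast
  have [measurable]: "g k \<in> borel_measurable borel" for k by (rule Lip_loc_borel_measurable[OF g])
  have inv0: "(\<lambda>k. ennreal (1 / ?c k)) \<longlonglongrightarrow> 0"
    using tendsto_ennrealI[OF LIMSEQ_inverse_real_of_nat] by (simp add: inverse_eq_divide)
  have conv: "tendsto_L1_loc m UNIV g ?\<chi>"
    unfolding tendsto_L1_loc_def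
  proof (intro ballI exI conjI)
    fix x :: 'a
    show "(0::real) < 1" by simp
    let ?A = "ball x 1"
    have [measurable]: "ball y r \<in> sets borel" for y :: 'a and r by simp
    let ?d = "\<lambda>k y. ennreal \<bar>ramp (?c k) t (v y) - ?\<chi> y\<bar>"
    have fin: "emeasure m ?A < \<infinity>" using m by (auto simp: metric_measure_def)
    have d0: "(\<lambda>k. \<integral>\<^sup>+y\<in>?A. ?d k y \<partial>m) \<longlonglongrightarrow> (\<integral>\<^sup>+y. 0 \<partial>m)"
    proof (rule nn_integral_dominated_convergence[where w="indicator ?A"])
      show "AE y in m. ?d k y * indicator ?A y \<le> indicator ?A y" for k
    proof (rule AE_I2)
      fix y
      have "\<bar>ramp (?c k) t (v y) - ?\<chi> y\<bar> \<le> 1"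
        using ramp_bounds[of "?c k" t "v y"] by (simp split: split_indicator del: of_nat_Suc)
      then show "?d k y * indicator ?A y \<le> indicator ?A y"
        by (simp split: split_indicator del: of_nat_Suc)
    qed
      show "AE y in m. (\<lambda>k. ?d k y * indicator ?A y) \<longlonglongrightarrow> 0"
      proof (rule AE_I2)
        fix y
        have "(\<lambda>k. \<bar>ramp (?c k) t (v y) - ?\<chi> y\<bar>) \<longlonglongrightarrow> \<bar>?\<chi> y - ?\<chi> y\<bar>"
          by (intro tendsto_intros ramp_tendsto_indicator)
        from tendsto_ennrealI[OF this] have "(\<lambda>k. ?d k y) \<longlonglongrightarrow> 0" by simp
        then show "(\<lambda>k. ?d k y * indicator ?A y) \<longlonglongrightarrow> 0"
          by (simp add: indicator_def)
      qed
      show "(\<lambda>y. ?d k y * indicator ?A y) \<in> borel_measurable m" for k by measurable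
      show "indicator ?A \<in> borel_measurable m"
        by (intro borel_measurable_indicator) (simp add: M)
      show "(\<integral>\<^sup>+y. indicator ?A y \<partial>m) < \<infinity>" using fin by (simp add: M)
    qed simp
    obtain K where K: "dist x0 x + 1 \<le> real K" using real_arch_simple by blast
    have le: "(\<integral>\<^sup>+y\<in>?A \<inter> UNIV. ennreal \<bar>g k y - ?\<chi> y\<bar> \<partial>m)
        \<le> ennreal (1 / ?c k) + (\<integral>\<^sup>+y\<in>?A. ?d k y \<partial>m)" if "k \<ge> K" for k
    proof -
      have sub: "?A \<subseteq> ball x0 (?c k)"
      proof
        fix y assume "y \<in> ?A"
        then have "dist x0 y < dist x0 x + 1" using dist_triangle[of x0 y x] by simp
        then show "y \<in> ball x0 (?c k)" using K that by simp
      qed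
      have "(\<integral>\<^sup>+y\<in>?A \<inter> UNIV. ennreal \<bar>g k y - ?\<chi> y\<bar> \<partial>m)
          \<le> (\<integral>\<^sup>+y. ennreal \<bar>g k y - ramp (?c k) t (v y)\<bar> * indicator (ball x0 (?c k)) y
                + ?d k y * indicator ?A y \<partial>m)"
      proof (rule nn_integral_mono)
        fix y
        show "ennreal \<bar>g k y - ?\<chi> y\<bar> * indicator (?A \<inter> UNIV) y
          \<le> ennreal \<bar>g k y - ramp (?c k) t (v y)\<bar> * indicator (ball x0 (?c k)) y
                + ?d k y * indicator ?A y"
        proof (cases "y \<in> ?A")
          case True
          have "ennreal \<bar>g k y - ?\<chi> y\<bar> \<le> ennreal (\<bar>g k y - ramp (?c k) t (v y)\<bar> + \<bar>ramp (?c k) t (v y) - ?\<chi> y\<bar>)"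
            by (intro ennreal_leI) simp
          also have "\<dots> = ennreal \<bar>g k y - ramp (?c k) t (v y)\<bar> + ?d k y"
            by (rule ennreal_plus) auto
          finally show ?thesis using True sub by (auto simp: indicator_def simp del: of_nat_Suc)
        qed simp
      qed
      also have "\<dots> = (\<integral>\<^sup>+y\<in>ball x0 (?c k). ennreal \<bar>g k y - ramp (?c k) t (v y)\<bar> \<partial>m)
                + (\<integral>\<^sup>+y\<in>?A. ?d k y \<partial>m)"
        by (rule nn_integral_add) measurable
      also have "\<dots> \<le> ennreal (1 / ?c k) + (\<integral>\<^sup>+y\<in>?A. ?d k y \<partial>m)"
        by (intro add_right_mono gr)
      finally show ?thesis .
    qed
    have "(\<lambda>k. ennreal (1 / ?c k) + (\<integral>\<^sup>+y\<in>?A. ?d k y \<partial>m)) \<longlonglongrightarrow> 0"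
      using tendsto_add[OF inv0 d0] by (simp del: of_nat_Suc)
    then show "(\<lambda>k. \<integral>\<^sup>+y\<in>?A \<inter> UNIV. ennreal \<bar>g k y - ?\<chi> y\<bar> \<partial>m) \<longlonglongrightarrow> 0"
      by (rule tendsto_ennreal_zero_le) (rule le)
  qed
  have "total_variation_open m ?\<chi> UNIV \<le> liminf (\<lambda>k. \<integral>\<^sup>+x\<in>UNIV. lip (g k) x \<partial>m)"
    by (rule total_variation_open_le[OF g conv])
  also have "\<dots> \<le> liminf (\<lambda>k. ennreal (1 / ?c k))"
    using gl by (intro Liminf_mono always_eventually) simp
  also have "\<dots> = 0" using inv0 by (intro lim_imp_Liminf) auto
  finally show ?thesis by simp
qed

section \<open>Perimeters and the extension argument\<close>

lemma restr_UNIV: "restr m UNIV = m"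
  by (simp add: restr_def density_1)

lemma perimeter_UNIV: "perimeter m UNIV F UNIV = total_variation_open m (indicator F) UNIV"
  by (simp add: perimeter_def restr_UNIV total_variation_UNIV)

text \<open>With respect to \<open>m|\<^sub>E\<close> the indicator of \<open>E\<close> is the constant \<open>1\<close> almost everywhere.\<close>

lemma perimeter_whole:
  assumes "E \<in> sets m"
  shows "perimeter m E E G = 0"
proof -
  have "AE x in restr m E. x \<in> E" unfolding restr_def
    using assms by (subst AE_density) (auto simp: indicator_def)
  then have ae: "(\<integral>\<^sup>+y\<in>ball x r \<inter> UNIV. ennreal \<bar>1 - indicator E y\<bar> \<partial>restr m E) = 0" for x r
    by (subst nn_integral_cong_AE[where v="\<lambda>_. 0"]) auto
  have "total_variation_open (restr m E) (indicator E) UNIV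
      \<le> liminf (\<lambda>n::nat. \<integral>\<^sup>+x\<in>UNIV. lip (\<lambda>_. 1) x \<partial>restr m E)"
  proof (rule total_variation_open_le)
    show "(\<lambda>_. 1) \<in> Lip_loc UNIV"
      unfolding Lip_loc_def
      by (clarify, rule exI[of _ 1], rule conjI, simp, rule exI[of _ 0], rule lipschitz_on_constant)
    show "tendsto_L1_loc (restr m E) UNIV (\<lambda>_ _. 1) (indicator E)"
      unfolding tendsto_L1_loc_def ae by (intro ballI exI[of _ 1] conjI) auto
  qed
  then have 0: "total_variation_open (restr m E) (indicator E) UNIV = 0"
    by (simp add: Liminf_const)
  have "perimeter m E E G \<le> total_variation_open (restr m E) (indicator E) UNIV"
    unfolding perimeter_def total_variation_def by (rule Inf_lower) auto
  with 0 show ?thesis by simp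
qed

lemma indicator_in_L1_loc:
  fixes m :: "'a::polish_space measure"
  assumes m: "metric_measure m" and E: "E \<in> sets borel" and F: "F \<in> sets borel"
  shows "indicator F \<in> L1_loc (restr m E)"
  unfolding L1_loc_def
proof (clarify)
  fix x :: 'a
  have M: "sets m = sets borel" using m by (simp add: metric_measure_def)
  have S: "sets (restr m E) = sets borel" by (simp add: restr_def M)
  have "emeasure (restr m E) (F \<inter> ball x 1) \<le> emeasure m (ball x 1)"
  proof -
    have "emeasure (restr m E) (F \<inter> ball x 1)
        = (\<integral>\<^sup>+y. indicator E y * indicator (F \<inter> ball x 1) y \<partial>m)"
      unfolding restr_def using E F
      by (intro emeasure_density borel_measurable_indicator) (simp_all add: M)
    also have "\<dots> \<le> (\<integral>\<^sup>+y. indicator (ball x 1) y \<partial>m)"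
      by (intro nn_integral_mono) (simp split: split_indicator)
    also have "\<dots> = emeasure m (ball x 1)" by (simp add: M)
    finally show ?thesis .
  qed
  also have "\<dots> < \<infinity>" using m by (auto simp: metric_measure_def)
  finally have fin: "emeasure (restr m E) (F \<inter> ball x 1) < \<infinity>" .
  have "integrable (restr m E) (indicator (F \<inter> ball x 1) :: 'a \<Rightarrow> real)"
    using fin F by (intro integrable_real_indicator) (simp_all add: S)
  then have "set_integrable (restr m E) (ball x 1) (indicator F :: 'a \<Rightarrow> real)"
    unfolding set_integrable_def
    by (simp add: indicator_inter_arith[abs_def] mult.commute[of "indicator F _"])
  then show "\<exists>r>0. set_integrable (restr m E) (ball x r) (indicator F :: 'a \<Rightarrow> real)"
    by (intro exI[of _ 1]) simp
qed

text \<open>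
  So in an indecomposable space a function of total variation zero is constant almost everywhere.
\<close>

lemma zero_variation_separates:
  fixes m :: "'a::polish_space measure"
  assumes m: "metric_measure m" 
    and v: "v \<in> borel_measurable borel" "total_variation_open m v UNIV = 0"
    and pos: "emeasure m {x. t < v x} > 0" "emeasure m {x. v x \<le> t} > 0"
  shows "decomposable m UNIV UNIV"
proof -
  let ?F = "{x. t < v x}"
  have M: "sets m = sets borel" using m by (simp add: metric_measure_def)
  have F: "?F \<in> sets borel" using v(1) by measurable
  have G: "{x. v x \<le> t} = - ?F" by auto
  have F0: "total_variation_open m (indicator ?F) UNIV = 0"
    by (rule superlevel_total_variation_zero[OF m v])
  have "1-lipschitz_on UNIV (\<lambda>s::real. 1 - s)"
    by (rule lipschitz_onI) (auto simp: dist_real_def)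
  from total_variation_open_compose_contraction[OF this, of m "indicator ?F" UNIV]
  have "total_variation_open m (indicator (- ?F)) UNIV = 0"
    using F0 by (simp add: indicator_compl[abs_def])
  then have "perimeter m UNIV UNIV UNIV = perimeter m UNIV ?F UNIV + perimeter m UNIV (- ?F) UNIV"
    using F0 perimeter_whole[of UNIV m UNIV] by (simp add: perimeter_UNIV M)
  moreover have "- ?F \<in> sets borel" using F by (rule borel_comp)
  moreover have "?F \<union> - ?F = UNIV \<inter> UNIV" "?F \<inter> - ?F = {}" by auto
  ultimately show ?thesis
    unfolding decomposable_def using F pos[unfolded G] by blast
qed

theorem lemma4p12:
  fixes m :: "'a::polish_space measure" and E :: "'a set"
  assumes "metric_measure m"
    and "indecomposable m UNIV UNIV"
    and "closed E"
    and "hBV_extension_set m E"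
  shows "indecomposable m E E"
proof
  assume "decomposable m E E"
  then obtain F G where F: "F \<in> sets borel" and G: "G \<in> sets borel"
    and FG: "F \<subseteq> E" "G \<subseteq> E" "F \<inter> G = {}" and pos: "emeasure m F > 0" "emeasure m G > 0"
    and P: "perimeter m E E E = perimeter m E F E + perimeter m E G E"
    unfolding decomposable_def by blast
  have M: "sets m = sets borel" using assms(1) by (simp add: metric_measure_def)
  have E: "E \<in> sets borel" using assms(3) by simp
  have "perimeter m E F E = 0" using P perimeter_whole[of E m E] E M by simp
  then have nF: "hBV_norm m E (indicator F) = 0" by (simp add: perimeter_def hBV_norm_def)
  then have Fin: "indicator F \<in> hBV m E"
    using indicator_in_L1_loc[OF assms(1) E F] by (simp add: hBV_def)
  obtain v where v: "v \<in> hBV m UNIV" and ext: "AE x in m. x \<in> E \<longrightarrow> v x = indicator F x"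
    and nv: "hBV_norm m UNIV v = 0"
  proof -
    from assms(4) obtain C T where "\<forall>u\<in>hBV m E. T u \<in> hBV m UNIV"
      "\<forall>u\<in>hBV m E. AE x in m. x \<in> E \<longrightarrow> T u x = u x"
      "\<forall>u\<in>hBV m E. hBV_norm m UNIV (T u) \<le> ennreal C * hBV_norm m E u"
      unfolding hBV_extension_set_def by blast
    then show ?thesis using Fin nF by (intro that[of "T (indicator F)"]) force+
  qed
  have vb: "v \<in> borel_measurable borel"
    using v by (intro L1_loc_borel_measurable[OF _ M]) (simp add: hBV_def restr_UNIV)
  have tv: "total_variation_open m v UNIV = 0"
    using nv by (simp add: hBV_norm_def restr_UNIV total_variation_UNIV)
  have "emeasure m F \<le> emeasure m {x. 0 < v x}"
  proof (rule emeasure_mono_AE)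
    show "AE x in m. x \<in> F \<longrightarrow> x \<in> {x. 0 < v x}"
      using ext by eventually_elim (use FG in auto)
    show "{x. 0 < v x} \<in> sets m" using vb by (simp add: M)
  qed
  moreover have "emeasure m G \<le> emeasure m {x. v x \<le> 0}"
  proof (rule emeasure_mono_AE)
    show "AE x in m. x \<in> G \<longrightarrow> x \<in> {x. v x \<le> 0}"
      using ext by eventually_elim (use FG in \<open>auto simp: indicator_def\<close>)
    show "{x. v x \<le> 0} \<in> sets m" using vb by (simp add: M)
  qed
  ultimately have "decomposable m UNIV UNIV"
    using pos by (intro zero_variation_separates[OF assms(1) vb tv, of 0]) auto
  with assms(2) show False by simp
qed

end
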